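(* Let $n\ge2$ and let $\lambda$ be a nonzero integral dominant $\mathfrak{sl}_n$-weight with coordinates $\lambda_1\ge\cdots\ge\lambda_{n-1}\ge0$ as below. Then $$\sum_{f\text{ face of }GT_\lambda}(-1)^{\dim f}\varphi(f)=\binom{n}{l_1,\ldots,l_m}_t=\frac{[n]_t!}{[l_1]_t!\cdots[l_m]_t!},$$ where $(l_1,\ldots,l_m)$ is the type of the partition $(\lambda_1,\ldots,\lambda_{n-1},0)$, i.e. its $r$-th largest distinct part occurs $l_r$ times.
   Context: If $\lambda=(a_1,\ldots,a_{n-1})$ in fundamental weights, $\lambda_i=a_i+\cdots+a_{n-1}$. The Gelfand–Tsetlin polytope $GT_\lambda$ is the set of real arrays $(s_{i,j})$, $0\le i\le n-1$, $1\le j\le n-i$, with $s_{0,j}=\lambda_j$ ($s_{0,n}=0$) and $s_{i,j}\ge s_{i+1,j}\ge s_{i,j+1}$ whenever defined. For a face $f$ take a point $A$ in its relative interior; $\varphi(f)=\prod_{l=1}^{n-1}(1-t^l)^{d_l}$ where $d_l$ is the number of pairs $(i,a)$, $1\le i\le n-1$, $a\in\mathbb R$, such that $a$ occurs exactly $l$ times in row $i$ of $A$ and exactly $l-1$ times in row $i-1$ (this depends only on $f$). $[l]_t!=\prod_{i=1}^l(1+t+\cdots+t^{i-1})$. *)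

theory Defs
  imports "HOL-Analysis.Analysis" "HOL-Computational_Algebra.Polynomial_Factorial"
begin

text \<open>
  Throughout, $n$ is the cardinality of the type variable \<open>'n\<close>.  The arrays $(s_{i,j})$ with
  $0 \le i \le n-1$ and $1 \le j \le n-i$ form the Euclidean space \<open>real ^ 'n gt_index\<close>, so that
  \<open>face_of\<close>, \<open>aff_dim\<close> and \<open>rel_interior\<close> are applicable to sets of arrays.
\<close>

typedef 'n gt_index =
  "{(i, j). i \<le> CARD('n::finite) - 1 \<and> 1 \<le> j \<and> j \<le> CARD('n) - i} :: (nat \<times> nat) set"
  morphisms gt_pos gt_at
proof
  show "(0, 1) \<in> {(i, j). i \<le> CARD('n) - 1 \<and> 1 \<le> j \<and> j \<le> CARD('n) - i}"
    by (simp add: Suc_le_eq)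
qed

instance gt_index :: (finite) finite
proof
  have "finite ({(i, j). i \<le> CARD('a) - 1 \<and> 1 \<le> j \<and> j \<le> CARD('a) - i} :: (nat \<times> nat) set)"
    by (rule finite_subset[of _ "{..CARD('a)} \<times> {..CARD('a)}"]) auto
  then show "finite (UNIV :: 'a gt_index set)"
    by (simp only: type_definition.univ[OF type_definition_gt_index] finite_imageI)
qed

text \<open>The entry $s_{i,j}$; only meaningful for positions $(i,j)$ inside the triangle.\<close>

definition entry :: "real ^ ('n::finite) gt_index \<Rightarrow> nat \<Rightarrow> nat \<Rightarrow> real" where
  "entry s i j = s $ gt_at (i, j)"

text \<open>
  \<open>a 1, \<dots>, a (n - 1)\<close> are the coordinates of the integral dominant weight in the basis of
  fundamental weights; all other values of \<open>a\<close> are irrelevant.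
\<close>

definition weight_coord :: "nat \<Rightarrow> (nat \<Rightarrow> nat) \<Rightarrow> nat \<Rightarrow> nat" where
  "weight_coord n a i = (\<Sum>k = i..n - 1. a k)"

definition GT_polytope :: "(nat \<Rightarrow> nat) \<Rightarrow> (real ^ ('n::finite) gt_index) set" where
  "GT_polytope a = {s.
     (\<forall>j \<in> {1..CARD('n) - 1}. entry s 0 j = real (weight_coord CARD('n) a j)) \<and>
     entry s 0 CARD('n) = 0 \<and>
     (\<forall>i j. i + 1 \<le> CARD('n) - 1 \<longrightarrow> 1 \<le> j \<longrightarrow> j \<le> CARD('n) - (i + 1) \<longrightarrow>
        entry s i j \<ge> entry s (i + 1) j \<and> entry s (i + 1) j \<ge> entry s i (j + 1))}"

definition row_mult :: "real ^ ('n::finite) gt_index \<Rightarrow> nat \<Rightarrow> real \<Rightarrow> nat" where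
  "row_mult s i x = card {j \<in> {1..CARD('n) - i}. entry s i j = x}"

definition d_number :: "real ^ ('n::finite) gt_index \<Rightarrow> nat \<Rightarrow> nat" where
  "d_number s l =
     card {(i, x). i \<in> {1..CARD('n) - 1} \<and> row_mult s i x = l \<and> row_mult s (i - 1) x = l - 1}"

abbreviation t_var :: "int poly" where
  "t_var \<equiv> [:0, 1:]"

definition array_weight :: "real ^ ('n::finite) gt_index \<Rightarrow> int poly" where
  "array_weight s = (\<Prod>l = 1..CARD('n) - 1. (1 - t_var ^ l) ^ d_number s l)"

text \<open>The value does not depend on the chosen point of the relative interior.\<close>

definition face_weight :: "(real ^ ('n::finite) gt_index) set \<Rightarrow> int poly" where
  "face_weight f = array_weight (SOME s. s \<in> rel_interior f)"

definition t_fact :: "nat \<Rightarrow> int poly" where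
  "t_fact l = (\<Prod>i = 1..l. \<Sum>k<i. t_var ^ k)"

definition t_multinomial :: "nat \<Rightarrow> nat list \<Rightarrow> int poly fract" where
  "t_multinomial n ls = to_fract (t_fact n) / (\<Prod>l\<leftarrow>ls. to_fract (t_fact l))"

definition partition_type :: "nat list \<Rightarrow> nat list" where
  "partition_type xs = map (count_list xs) (rev (sorted_list_of_set (set xs)))"

end

theory Submission
  imports Defs
begin

text \<open>
  The weight of a face is constant on its relative interior and \<open>(-1)\<close> to its dimension is the
  compactly supported Euler characteristic of that interior, so the sum is an Euler characteristic
  integral over the polytope, and it can be evaluated row by row.

  A face is determined by the ties (tight inequalities) at a point of its relative interior, and
  each such set of ties is realised by exactly one array in which every entry equals one of its two
  upper neighbours or their midpoint. The dimension of the face is the number of entries that differ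
  from both upper neighbours. The sum over these arrays factors into transitions between consecutive
  rows. By induction the contribution of all rows below the second one is the multinomial of that
  row, and it remains to see that the weights of all second rows, each multiplied by the quotient of
  the products \<open>[l\<^sub>1]\<^sub>t! \<dots> [l\<^sub>m]\<^sub>t!\<close> of the two rows, add up to \<open>[n]\<^sub>t\<close>. Reading the top row from
  left to right this sum obeys the recursion \<open>[l + n]\<^sub>t = [l]\<^sub>t + t\<^sup>l [n]\<^sub>t\<close>.
\<close>

subsection \<open>Weights of consecutive rows\<close>

definition q_num :: "'a::comm_ring_1 \<Rightarrow> nat \<Rightarrow> 'a" where
  "q_num t l = (\<Sum>k<l. t ^ k)"

definition q_fact :: "'a::comm_ring_1 \<Rightarrow> nat \<Rightarrow> 'a" where
  "q_fact t l = (\<Prod>i = 1..l. q_num t i)"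

lemma q_num_1 [simp]: "q_num t (Suc 0) = 1"
  by (simp add: q_num_def)

lemma q_num_add: "q_num t (k + l) = q_num t k + t ^ k * q_num t l"
  by (induction l) (simp_all add: q_num_def algebra_simps power_add)

lemma one_minus_mult_q_num: "(1 - t) * q_num t l = 1 - t ^ l"
  by (simp add: q_num_def one_diff_power_eq)

lemma q_fact_0 [simp]: "q_fact t 0 = 1"
  by (simp add: q_fact_def)

lemma q_fact_Suc: "q_fact t (Suc l) = q_num t (Suc l) * q_fact t l"
  by (simp add: q_fact_def mult.commute)

lemma count_list_replicate: "count_list (replicate k v) x = (if x = v then k else 0)"
  by (induction k) auto

lemma count_list_map_distinct:
  assumes "distinct xs"
  shows "count_list (map f xs) y = card {x \<in> set xs. f x = y}"
proof -
  have "count_list (map f xs) y = length (filter (\<lambda>x. f x = y) xs)"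
    by (simp add: count_list_eq_length_filter filter_map o_def eq_commute)
  then show ?thesis using assms by (simp add: distinct_length_filter Int_def conj_commute)
qed

lemma count_list_map_inj_on:
  assumes "inj_on h (insert x (set r))"
  shows "count_list (map h r) (h x) = count_list r x"
  using assms by (induction r) (auto simp: inj_on_def)

lemma decreasing_eq_iff_cong:
  fixes f :: "nat \<Rightarrow> 'a::linorder" and f' :: "nat \<Rightarrow> 'b::linorder"
  assumes "\<And>k. k < N \<Longrightarrow> f (Suc k) \<le> f k" "\<And>k. k < N \<Longrightarrow> f' (Suc k) \<le> f' k"
    and "\<And>k. k < N \<Longrightarrow> f (Suc k) = f k \<longleftrightarrow> f' (Suc k) = f' k"
    and "a \<le> N" "b \<le> N"
  shows "f a = f b \<longleftrightarrow> f' a = f' b"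
proof -
  have "f b \<le> f a \<and> f' b \<le> f' a \<and> (f a = f b \<longleftrightarrow> f' a = f' b)" if "a \<le> b" "b \<le> N" for a b
    using that
  proof (induction b rule: dec_induct)
    case (step b)
    then show ?case
      using assms(1-3)[of b] by auto
  qed simp
  then show ?thesis
    using assms(4,5) by (metis nat_le_linear)
qed

lemma set_Cons_eq_image: "set_Cons A B = case_prod (#) ` (A \<times> B)"
  by (auto simp: set_Cons_def)

lemma finite_set_Cons [simp]: "finite A \<Longrightarrow> finite B \<Longrightarrow> finite (set_Cons A B)"
  by (simp add: set_Cons_eq_image)

lemma sum_set_Cons: "(\<Sum>xs\<in>set_Cons A B. f xs) = (\<Sum>x\<in>A. \<Sum>xs\<in>B. f (x # xs))"
  unfolding set_Cons_eq_image
  by (subst sum.reindex) (auto simp: inj_on_def sum.cartesian_product case_prod_unfold)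

text \<open>
  One point of each relatively open cell of the interval between two upper neighbours: its two ends
  and its interior.
\<close>

definition cell_points :: "'v::field \<Rightarrow> 'v \<Rightarrow> 'v set" where
  "cell_points x y = {x, y, (x + y) / 2}"

lemma finite_cell_points [simp]: "finite (cell_points x y)"
  by (simp add: cell_points_def)

lemma cell_points_between:
  fixes x y :: "'v::linordered_field"
  assumes "c \<in> cell_points x y" "y \<le> x"
  shows "y \<le> c" "c \<le> x"
  using assms by (auto simp: cell_points_def field_simps)

fun next_rows :: "'v::linordered_field list \<Rightarrow> 'v list set" where
  "next_rows (x # y # zs) = set_Cons (cell_points x y) (next_rows (y # zs))"
| "next_rows _ = {[]}"

fun free_entries :: "'v list \<Rightarrow> 'v list \<Rightarrow> nat" where
  "free_entries (x # y # zs) (c # r) = (if c = x \<or> c = y then 0 else 1) + free_entries (y # zs) r"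
| "free_entries _ _ = 0"

lemma finite_next_rows [simp]: "finite (next_rows r)"
  by (induction r rule: next_rows.induct) auto

lemma mem_next_rows_iff:
  assumes "r \<noteq> []"
  shows "r' \<in> next_rows r \<longleftrightarrow> length r = Suc (length r') \<and>
    (\<forall>j < length r'. r' ! j \<in> cell_points (r ! j) (r ! Suc j))"
  using assms
proof (induction r arbitrary: r' rule: next_rows.induct)
  case (1 x y zs)
  show ?case
  proof (cases r')
    case (Cons c r'')
    then have "r' \<in> next_rows (x # y # zs) \<longleftrightarrow> c \<in> cell_points x y \<and> r'' \<in> next_rows (y # zs)"
      by (auto simp: set_Cons_def)
    then show ?thesis
      using "1.IH"[of r''] Cons by (simp add: All_less_Suc2) blast
  qed (auto simp: set_Cons_def)
qed auto

lemma free_entries_eq_card: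
  assumes "length r = Suc (length r')"
  shows "free_entries r r' = card {j. j < length r' \<and> r' ! j \<noteq> r ! j \<and> r' ! j \<noteq> r ! Suc j}"
proof -
  have "free_entries r r' = (\<Sum>j < length r'. if r' ! j \<noteq> r ! j \<and> r' ! j \<noteq> r ! Suc j then 1 else 0)"
    using assms
    by (induction r r' rule: free_entries.induct)
      (auto simp: sum.lessThan_Suc_shift simp del: sum.lessThan_Suc)
  also have "\<dots> = card {j. j < length r' \<and> r' ! j \<noteq> r ! j \<and> r' ! j \<noteq> r ! Suc j}"
    by (subst sum.inter_filter[symmetric]) (auto intro: arg_cong[where f = card])
  finally show ?thesis .
qed

lemma next_rows_le_hd:
  assumes "r' \<in> next_rows r" "sorted_wrt (\<ge>) r" "z \<in> set r'"
  shows "z \<le> hd r"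
  using assms
proof (induction r arbitrary: r' rule: next_rows.induct)
  case (1 x y zs)
  then show ?case by (force simp: set_Cons_def dest: cell_points_between(2))
qed auto

lemma next_rows_decreasing:
  assumes "r' \<in> next_rows r" "sorted_wrt (\<ge>) r"
  shows "sorted_wrt (\<ge>) r'"
  using assms
proof (induction r arbitrary: r' rule: next_rows.induct)
  case (1 x y zs)
  then obtain c r'' where r': "r' = c # r''" "c \<in> cell_points x y" "r'' \<in> next_rows (y # zs)"
    by (auto simp: set_Cons_def)
  have "y \<le> c"
    using cell_points_between(1)[OF r'(2)] "1.prems"(2) by simp
  moreover have "z \<le> y" if "z \<in> set r''" for z
    using next_rows_le_hd[OF r'(3) _ that] "1.prems"(2) by simp
  ultimately show ?case
    using r' "1.IH"[OF r'(3)] "1.prems"(2) by force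
qed auto

lemma count_list_next_rows:
  assumes "r' \<in> next_rows r" "sorted_wrt (\<ge>) r"
  shows "count_list r z \<le> Suc (count_list r' z)"
    and "count_list r' z \<le> Suc (count_list r z)"
proof -
  have "count_list r z \<le> Suc (count_list r' z) \<and> count_list r' z \<le> Suc (count_list r z) \<and>
      (r \<noteq> [] \<and> z = hd r \<longrightarrow> count_list r' z \<le> count_list r z)"
    using assms
  proof (induction r arbitrary: r' rule: next_rows.induct)
    case (1 x y zs)
    then obtain c r'' where r': "r' = c # r''" "c \<in> cell_points x y" "r'' \<in> next_rows (y # zs)"
      by (auto simp: set_Cons_def)
    have dec: "sorted_wrt (\<ge>) (y # zs)" and "y \<le> x"
      using "1.prems"(2) by auto
    note IH = "1.IH"[OF r'(3) dec]
    show ?case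
    proof (cases "z \<le> y")
      case True
      then show ?thesis
        using IH r'(1,2) \<open>y \<le> x\<close> by (auto simp: cell_points_def field_simps)
    next
      case False
      then have "z \<notin> set (y # zs)" "z \<notin> set r''"
        using dec next_rows_le_hd[OF r'(3) dec] by auto
      then show ?thesis using r'(1,2) False by auto
    qed
  qed auto
  then show "count_list r z \<le> Suc (count_list r' z)" "count_list r' z \<le> Suc (count_list r z)"
    by blast+
qed

definition step_factor :: "'a::comm_ring_1 \<Rightarrow> nat \<Rightarrow> nat \<Rightarrow> 'a" where
  "step_factor t p q = (if q = Suc p then 1 - t ^ q else 1)"

definition row_weight :: "'a::comm_ring_1 \<Rightarrow> 'v list \<Rightarrow> 'v list \<Rightarrow> 'a" where
  "row_weight t r r' = (\<Prod>x\<in>set r'. step_factor t (count_list r x) (count_list r' x))"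

definition count_fact :: "'a::comm_ring_1 \<Rightarrow> 'v list \<Rightarrow> 'a" where
  "count_fact t r = (\<Prod>x\<in>set r. q_fact t (count_list r x))"

lemma row_weight_eq_prod_increments:
  "row_weight t r r' = (\<Prod>x | count_list r' x = Suc (count_list r x). 1 - t ^ count_list r' x)"
proof -
  have "{x. count_list r' x = Suc (count_list r x)} =
      {x \<in> set r'. count_list r' x = Suc (count_list r x)}"
    using count_notin by fastforce
  then show ?thesis
    by (simp only: row_weight_def step_factor_def prod.inter_filter finite_set)
qed

lemma row_weight_map:
  assumes "inj_on h (set r \<union> set r')"
  shows "row_weight t (map h r) (map h r') = row_weight t r r'"
proof -
  have "row_weight t (map h r) (map h r') =
      (\<Prod>x\<in>set r'. step_factor t (count_list (map h r) (h x)) (count_list (map h r') (h x)))"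
    unfolding row_weight_def set_map
    by (subst prod.reindex) (use assms in \<open>auto intro: inj_on_subset\<close>)
  also have "\<dots> = row_weight t r r'"
    unfolding row_weight_def
    by (intro prod.cong refl arg_cong2[where f = "step_factor t"] count_list_map_inj_on
        inj_on_subset[OF assms]) auto
  finally show ?thesis .
qed

lemma row_weight_map_cong:
  assumes "\<And>a b. a \<in> set xs \<union> set ys \<Longrightarrow> b \<in> set xs \<union> set ys \<Longrightarrow> f a = f b \<longleftrightarrow> f' a = f' b"
  shows "row_weight t (map f xs) (map f ys) = row_weight t (map f' xs) (map f' ys)"
proof -
  let ?A = "set xs \<union> set ys"
  define h where "h = f' \<circ> inv_into ?A f"
  have h: "h (f a) = f' a" if "a \<in> ?A" for a
    using assms[of "inv_into ?A f (f a)" a] that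
      inv_into_into[of "f a" f ?A] f_inv_into_f[of "f a" f ?A]
    by (simp add: h_def)
  then have "map f' xs = map h (map f xs)" "map f' ys = map h (map f ys)"
    by simp_all
  moreover have "inj_on h (set (map f xs) \<union> set (map f ys))"
    unfolding set_map image_Un[symmetric] by (rule inj_onI) (use h assms in auto)
  ultimately show ?thesis by (simp only: row_weight_map)
qed

lemma count_fact_map:
  assumes "inj_on h (set r)"
  shows "count_fact t (map h r) = count_fact t r"
  using assms by (simp add: count_fact_def prod.reindex count_list_inj_map)

text \<open>
  The scaled weight is the row weight times the quotient of the multinomials of the two rows, up to
  the factor \<open>q_num t (length r)\<close>; no division is needed because the multiplicities of a value in
  consecutive rows differ by at most one.
\<close>

definition scaled_factor :: "'a::comm_ring_1 \<Rightarrow> nat \<Rightarrow> nat \<Rightarrow> 'a" where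
  "scaled_factor t p q = (if q = Suc p then 1 - t else if p = Suc q then q_num t p else 1)"

definition scaled_weight :: "'a::comm_ring_1 \<Rightarrow> 'v list \<Rightarrow> 'v list \<Rightarrow> 'a" where
  "scaled_weight t r r' =
     (\<Prod>x\<in>set r \<union> set r'. scaled_factor t (count_list r x) (count_list r' x))"

lemma scaled_factor_simps [simp]:
  "scaled_factor t k k = 1"
  "scaled_factor t (Suc k) k = q_num t (Suc k)"
  "scaled_factor t k (Suc k) = 1 - t"
  by (simp_all add: scaled_factor_def)

lemma step_factor_mult_q_fact:
  assumes "p \<le> Suc q" "q \<le> Suc p"
  shows "step_factor t p q * q_fact t p = scaled_factor t p q * q_fact t q"
proof -
  consider (equal) "p = q" | (drop) "p = Suc q" | (rise) "q = Suc p"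
    using assms by linarith
  then show ?thesis
  proof cases
    case rise
    have "(1 - t ^ Suc p) * q_fact t p = (1 - t) * (q_num t (Suc p) * q_fact t p)"
      by (simp only: one_minus_mult_q_num mult.assoc[symmetric])
    then show ?thesis
      using rise by (simp add: step_factor_def q_fact_Suc)
  qed (simp_all add: step_factor_def q_fact_Suc)
qed

lemma scaled_weight_eq_prod_superset:
  assumes "finite U" "set r \<union> set r' \<subseteq> U"
  shows "scaled_weight t r r' = (\<Prod>x\<in>U. scaled_factor t (count_list r x) (count_list r' x))"
  unfolding scaled_weight_def using assms by (intro prod.mono_neutral_left) auto

lemma row_weight_mult_count_fact:
  assumes "r' \<in> next_rows r" "sorted_wrt (\<ge>) r"
  shows "row_weight t r r' * count_fact t r = scaled_weight t r r' * count_fact t r'"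
proof -
  let ?U = "set r \<union> set r'"
  have "row_weight t r r' = (\<Prod>x\<in>?U. step_factor t (count_list r x) (count_list r' x))"
    unfolding row_weight_def by (rule prod.mono_neutral_left) (auto simp: step_factor_def)
  moreover have "count_fact t r = (\<Prod>x\<in>?U. q_fact t (count_list r x))"
    unfolding count_fact_def by (rule prod.mono_neutral_left) auto
  moreover have "count_fact t r' = (\<Prod>x\<in>?U. q_fact t (count_list r' x))"
    unfolding count_fact_def by (rule prod.mono_neutral_left) auto
  ultimately show ?thesis
    by (simp add: scaled_weight_def step_factor_mult_q_fact[OF count_list_next_rows[OF assms]]
        flip: prod.distrib)
qed

lemma scaled_weight_replicate_append:
  assumes "v \<notin> set r" "v \<notin> set r'"
  shows "scaled_weight t (replicate k v @ r) (replicate l v @ r') =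
    scaled_factor t k l * scaled_weight t r r'"
proof -
  let ?U = "set r \<union> set r'"
  let ?upper = "replicate k v @ r" and ?lower = "replicate l v @ r'"
  let ?f = "\<lambda>x. scaled_factor t (count_list ?upper x) (count_list ?lower x)"
  have "scaled_weight t ?upper ?lower = prod ?f (insert v ?U)"
    by (rule scaled_weight_eq_prod_superset) auto
  also have "\<dots> = ?f v * prod ?f ?U"
    using assms by (simp del: count_list_append)
  also have "?f v = scaled_factor t k l"
    using assms by (simp add: count_list_replicate)
  also have "prod ?f ?U = scaled_weight t r r'"
    unfolding scaled_weight_def using assms by (intro prod.cong) (auto simp: count_list_replicate)
  finally show ?thesis .
qed

text \<open>
  \<open>k\<close> copies of the leading value of \<open>r\<close> have already been read off the upper row, and \<open>l\<close>
  copies off the lower one. Only \<open>l = k\<close> and \<open>l = k + 1\<close> occur; in the latter case the last free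
  entry has come down to the leading value.
\<close>

definition block_sum :: "'a::comm_ring_1 \<Rightarrow> nat \<Rightarrow> nat \<Rightarrow> 'v::linordered_field list \<Rightarrow> 'a" where
  "block_sum t k l r = (\<Sum>r'\<in>next_rows r. (-1) ^ free_entries r r' *
     scaled_weight t (replicate k (hd r) @ r) (replicate l (hd r) @ r'))"

lemma block_sum_singleton: "block_sum t k l [v] = scaled_factor t (Suc k) l"
  using scaled_weight_replicate_append[of v "[]" "[]" t "Suc k" l]
  by (simp add: block_sum_def replicate_append_same scaled_weight_def)

lemma block_sum_same: "block_sum t k l (x # x # zs) = block_sum t (Suc k) (Suc l) (x # zs)"
  by (simp add: block_sum_def sum_set_Cons cell_points_def replicate_app_Cons_same)

lemma scaled_weight_next_row:
  assumes "sorted_wrt (\<ge>) (x # y # zs)" "y < x" "r \<in> next_rows (y # zs)"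
  shows "scaled_weight t (replicate k x @ x # y # zs) (replicate l x @ x # r) =
      scaled_factor t (Suc k) (Suc l) * scaled_weight t (y # zs) r"
    and "scaled_weight t (replicate k x @ x # y # zs) (replicate l x @ y # r) =
      scaled_factor t (Suc k) l * scaled_weight t (y # zs) (y # r)"
    and "y < m \<Longrightarrow> m < x \<Longrightarrow>
      scaled_weight t (replicate k x @ x # y # zs) (replicate l x @ m # r) =
      scaled_factor t (Suc k) l * ((1 - t) * scaled_weight t (y # zs) r)"
proof -
  have below: "z \<le> y" if "z \<in> set r \<union> set (y # zs)" for z
    using that assms(1) next_rows_le_hd[OF assms(3)] by auto
  have lead: "replicate k x @ x # y # zs = replicate (Suc k) x @ y # zs"
    by (simp add: replicate_app_Cons_same)
  have "scaled_weight t (replicate (Suc k) x @ y # zs) (replicate (Suc l) x @ r) =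
      scaled_factor t (Suc k) (Suc l) * scaled_weight t (y # zs) r"
    by (rule scaled_weight_replicate_append) (use below assms(2) in force)+
  then show "scaled_weight t (replicate k x @ x # y # zs) (replicate l x @ x # r) =
      scaled_factor t (Suc k) (Suc l) * scaled_weight t (y # zs) r"
    by (simp add: replicate_app_Cons_same)
  show "scaled_weight t (replicate k x @ x # y # zs) (replicate l x @ y # r) =
      scaled_factor t (Suc k) l * scaled_weight t (y # zs) (y # r)"
    unfolding lead by (rule scaled_weight_replicate_append) (use below assms(2) in force)+
  assume m: "y < m" "m < x"
  have "scaled_weight t (replicate k x @ x # y # zs) (replicate l x @ m # r) =
      scaled_factor t (Suc k) l * scaled_weight t (y # zs) (m # r)"
    unfolding lead by (rule scaled_weight_replicate_append) (use below assms(2) m in force)+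
  also have "scaled_weight t (y # zs) (m # r) = (1 - t) * scaled_weight t (y # zs) r"
    using scaled_weight_replicate_append[of m "y # zs" r t 0 1] below m by force
  finally show "scaled_weight t (replicate k x @ x # y # zs) (replicate l x @ m # r) =
      scaled_factor t (Suc k) l * ((1 - t) * scaled_weight t (y # zs) r)" .
qed

lemma block_sum_less:
  assumes dec: "sorted_wrt (\<ge>) (x # y # zs)" and "y < x"
  shows "block_sum t k l (x # y # zs) =
    scaled_factor t (Suc k) (Suc l) * block_sum t 0 0 (y # zs) +
    scaled_factor t (Suc k) l * block_sum t 0 1 (y # zs) -
    scaled_factor t (Suc k) l * (1 - t) * block_sum t 0 0 (y # zs)"
proof -
  define m where "m = (x + y) / 2"
  have m: "y < m" "m < x"
    using \<open>y < x\<close> by (simp_all add: m_def field_simps)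
  note weight = scaled_weight_next_row[OF assms]
  let ?N = "next_rows (y # zs)" and ?s = "\<lambda>r. (-1) ^ free_entries (y # zs) r"
  let ?w = "\<lambda>c r. scaled_weight t (replicate k x @ x # y # zs) (replicate l x @ c # r)"
  have "block_sum t k l (x # y # zs) =
      (\<Sum>c\<in>{x, y, m}. \<Sum>r\<in>?N. (-1) ^ free_entries (x # y # zs) (c # r) * ?w c r)"
    by (simp only: block_sum_def next_rows.simps(1) sum_set_Cons cell_points_def m_def list.sel)
  also have "\<dots> = (\<Sum>r\<in>?N. ?s r * ?w x r) + (\<Sum>r\<in>?N. ?s r * ?w y r) - (\<Sum>r\<in>?N. ?s r * ?w m r)"
    using m by (simp add: sum_negf)
  also have "(\<Sum>r\<in>?N. ?s r * ?w x r) = scaled_factor t (Suc k) (Suc l) * block_sum t 0 0 (y # zs)"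
    by (simp add: block_sum_def weight(1) sum_distrib_left mult.left_commute cong: sum.cong)
  also have "(\<Sum>r\<in>?N. ?s r * ?w y r) = scaled_factor t (Suc k) l * block_sum t 0 1 (y # zs)"
    by (simp add: block_sum_def weight(2) sum_distrib_left mult.left_commute cong: sum.cong)
  also have "(\<Sum>r\<in>?N. ?s r * ?w m r) =
      scaled_factor t (Suc k) l * (1 - t) * block_sum t 0 0 (y # zs)"
    by (simp add: block_sum_def weight(3)[OF _ m] sum_distrib_left mult_ac cong: sum.cong)
  finally show ?thesis .
qed

lemma block_sum_eq:
  assumes "sorted_wrt (\<ge>) r" "r \<noteq> []"
  shows "block_sum t k k r = q_num t (k + length r) \<and> block_sum t k (Suc k) r = 1"
  using assms
proof (induction r arbitrary: k rule: next_rows.induct)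
  case (1 x y zs)
  have dec: "sorted_wrt (\<ge>) (y # zs)"
    using "1.prems"(1) by simp
  note IH = "1.IH"[OF dec list.distinct(2)]
  show ?case
  proof (cases "x = y")
    case True
    then show ?thesis using IH[of "Suc k"] by (simp add: block_sum_same)
  next
    case False
    then have "y < x" using "1.prems"(1) by auto
    note recursion = block_sum_less[OF "1.prems"(1) this]
    let ?n = "length (y # zs)"
    have "q_num t (Suc k + ?n) = q_num t (Suc k) + (1 - (1 - t) * q_num t (Suc k)) * q_num t ?n"
      unfolding one_minus_mult_q_num q_num_add[of t "Suc k" ?n] by simp
    then have "block_sum t k k (x # y # zs) = q_num t (Suc k + ?n)"
      unfolding recursion using IH[of 0] by (simp add: algebra_simps)
    moreover have "block_sum t k (Suc k) (x # y # zs) = 1"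
      unfolding recursion using IH[of 0] by simp
    ultimately show ?thesis by simp
  qed
qed (simp_all add: block_sum_singleton)

subsection \<open>Chains of rows\<close>

fun walks :: "('a \<Rightarrow> 'a set) \<Rightarrow> nat \<Rightarrow> 'a \<Rightarrow> 'a list set" where
  "walks N 0 x = {[x]}"
| "walks N (Suc m) x = (\<Union>y\<in>N x. (#) x ` walks N m y)"

definition walk_weight :: "('a \<Rightarrow> 'a \<Rightarrow> 'b::comm_monoid_mult) \<Rightarrow> 'a list \<Rightarrow> 'b" where
  "walk_weight w xs = (\<Prod>i<length xs - 1. w (xs ! i) (xs ! Suc i))"

lemma mem_walks_iff:
  "xs \<in> walks N m x \<longleftrightarrow> length xs = Suc m \<and> xs ! 0 = x \<and> (\<forall>i<m. xs ! Suc i \<in> N (xs ! i))"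
proof (induction m arbitrary: x xs)
  case 0
  then show ?case by (cases xs) auto
next
  case (Suc m)
  show ?case
  proof (cases xs)
    case (Cons x' ys)
    then have "xs \<in> walks N (Suc m) x \<longleftrightarrow> x' = x \<and> (\<exists>y\<in>N x. ys \<in> walks N m y)"
      by auto
    then show ?thesis
      using Cons by (auto simp: Suc.IH All_less_Suc2)
  qed auto
qed

lemma finite_walks:
  assumes "\<And>x. finite (N x)"
  shows "finite (walks N m x)"
  using assms by (induction m arbitrary: x) auto

lemma walk_weight_Cons: "xs \<noteq> [] \<Longrightarrow> walk_weight w (x # xs) = w x (xs ! 0) * walk_weight w xs"
  by (cases xs) (simp_all add: walk_weight_def prod.lessThan_Suc_shift del: prod.lessThan_Suc)

lemma sum_walk_weight_Suc:
  fixes w :: "'a \<Rightarrow> 'a \<Rightarrow> 'b::comm_semiring_1"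
  assumes "\<And>x. finite (N x)"
  shows "(\<Sum>xs\<in>walks N (Suc m) x. walk_weight w xs) =
    (\<Sum>y\<in>N x. w x y * (\<Sum>xs\<in>walks N m y. walk_weight w xs))"
proof -
  have "(\<Sum>xs\<in>walks N (Suc m) x. walk_weight w xs) =
      (\<Sum>y\<in>N x. \<Sum>xs\<in>(#) x ` walks N m y. walk_weight w xs)"
    unfolding walks.simps using assms
    by (intro sum.UNION_disjoint) (auto simp: finite_walks mem_walks_iff)
  also have "\<dots> = (\<Sum>y\<in>N x. \<Sum>xs\<in>walks N m y. w x y * walk_weight w xs)"
  proof (rule sum.cong[OF refl])
    fix y
    have "(\<Sum>xs\<in>(#) x ` walks N m y. walk_weight w xs) = (\<Sum>xs\<in>walks N m y. walk_weight w (x # xs))"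
      by (subst sum.reindex) auto
    also have "\<dots> = (\<Sum>xs\<in>walks N m y. w x y * walk_weight w xs)"
      by (intro sum.cong refl, subst walk_weight_Cons) (auto simp: mem_walks_iff)
    finally show "(\<Sum>xs\<in>(#) x ` walks N m y. walk_weight w xs) =
        (\<Sum>xs\<in>walks N m y. w x y * walk_weight w xs)" .
  qed
  finally show ?thesis by (simp add: sum_distrib_left)
qed

definition signed_row_weight :: "'a::comm_ring_1 \<Rightarrow> 'v list \<Rightarrow> 'v list \<Rightarrow> 'a" where
  "signed_row_weight t r r' = (-1) ^ free_entries r r' * row_weight t r r'"

theorem sum_walks_mult_count_fact:
  assumes "sorted_wrt (\<ge>) r" "length r = Suc m"
  shows "(\<Sum>c\<in>walks next_rows m r. walk_weight (signed_row_weight t) c) * count_fact t r =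
    q_fact t (Suc m)"
  using assms
proof (induction m arbitrary: r)
  case 0
  then obtain x where "r = [x]" by (auto simp: length_Suc_conv)
  then show ?case by (simp add: count_fact_def walk_weight_def q_fact_Suc)
next
  case (Suc m)
  let ?S = "\<lambda>m r. \<Sum>c\<in>walks next_rows m r. walk_weight (signed_row_weight t) c"
  have "r \<noteq> []" using Suc.prems by auto
  have "?S (Suc m) r * count_fact t r =
      (\<Sum>r'\<in>next_rows r. signed_row_weight t r r' * ?S m r' * count_fact t r)"
    by (simp only: sum_walk_weight_Suc[OF finite_next_rows] sum_distrib_right)
  also have "\<dots> = (\<Sum>r'\<in>next_rows r.
      (-1) ^ free_entries r r' * scaled_weight t r r' * q_fact t (Suc m))"
  proof (rule sum.cong[OF refl])
    fix r' assume r': "r' \<in> next_rows r"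
    have "length r' = Suc m"
      using r' \<open>r \<noteq> []\<close> Suc.prems by (simp add: mem_next_rows_iff)
    have "signed_row_weight t r r' * ?S m r' * count_fact t r =
        (-1) ^ free_entries r r' * ?S m r' * (row_weight t r r' * count_fact t r)"
      by (simp add: signed_row_weight_def mult_ac)
    also have "\<dots> = (-1) ^ free_entries r r' * scaled_weight t r r' * (?S m r' * count_fact t r')"
      unfolding row_weight_mult_count_fact[OF r' Suc.prems(1)] by (simp only: mult_ac)
    also have "?S m r' * count_fact t r' = q_fact t (Suc m)"
      by (rule Suc.IH[OF next_rows_decreasing[OF r' Suc.prems(1)] \<open>length r' = Suc m\<close>])
    finally show "signed_row_weight t r r' * ?S m r' * count_fact t r =
        (-1) ^ free_entries r r' * scaled_weight t r r' * q_fact t (Suc m)" .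
  qed
  also have "\<dots> = block_sum t 0 0 r * q_fact t (Suc m)"
    by (simp add: block_sum_def sum_distrib_right)
  also have "\<dots> = q_fact t (Suc (Suc m))"
    using block_sum_eq[OF Suc.prems(1) \<open>r \<noteq> []\<close>, of t 0] Suc.prems(2) by (simp add: q_fact_Suc)
  finally show ?case .
qed

subsection \<open>Faces of marked order polytopes\<close>

definition marked_order_polytope ::
    "('i::finite \<times> 'i) set \<Rightarrow> 'i set \<Rightarrow> ('i \<Rightarrow> real) \<Rightarrow> (real ^ 'i) set" where
  "marked_order_polytope R M g = {s. (\<forall>p\<in>M. s $ p = g p) \<and> (\<forall>(p, q)\<in>R. s $ q \<le> s $ p)}"

definition ties :: "('i::finite \<times> 'i) set \<Rightarrow> real ^ 'i \<Rightarrow> ('i \<times> 'i) set" where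
  "ties R s = {(p, q) \<in> R. s $ q = s $ p}"

definition tie_face ::
    "('i::finite \<times> 'i) set \<Rightarrow> 'i set \<Rightarrow> ('i \<Rightarrow> real) \<Rightarrow> real ^ 'i \<Rightarrow> (real ^ 'i) set" where
  "tie_face R M g s = {x \<in> marked_order_polytope R M g. ties R s \<subseteq> ties R x}"

definition tie_flat ::
    "('i::finite \<times> 'i) set \<Rightarrow> 'i set \<Rightarrow> ('i \<Rightarrow> real) \<Rightarrow> real ^ 'i \<Rightarrow> (real ^ 'i) set" where
  "tie_flat R M g s = {x. (\<forall>p\<in>M. x $ p = g p) \<and> ties R s \<subseteq> ties R x}"

lemma ties_subset_iff: "ties R s \<subseteq> ties R x \<longleftrightarrow> (\<forall>(p, q)\<in>R. s $ q = s $ p \<longrightarrow> x $ q = x $ p)"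
  by (auto simp: ties_def)

lemma convex_marked_order_polytope: "convex (marked_order_polytope R M g)"
proof -
  have "marked_order_polytope R M g = (\<Inter>p\<in>M. {x. axis p 1 \<bullet> x = g p}) \<inter>
      (\<Inter>(p, q)\<in>R. {x. (axis q 1 - axis p 1) \<bullet> x \<le> 0})"
    by (auto simp: marked_order_polytope_def inner_diff_left inner_axis')
  then show ?thesis
    by (auto intro!: convex_Int convex_INT convex_hyperplane convex_halfspace_le)
qed

lemma tie_face_face_of: "tie_face R M g s face_of marked_order_polytope R M g"
proof -
  let ?P = "marked_order_polytope R M g"
  have as_Inter: "tie_face R M g s =
      \<Inter> (insert ?P ((\<lambda>(p, q). ?P \<inter> {x. (axis q 1 - axis p 1) \<bullet> x = 0}) ` ties R s))"
    by (auto simp: tie_face_def ties_def inner_diff_left inner_axis')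
  have "?P \<inter> {x. (axis q 1 - axis p 1) \<bullet> x = 0} face_of ?P" if "(p, q) \<in> ties R s" for p q
    using that
    by (intro face_of_Int_supporting_hyperplane_le convex_marked_order_polytope)
      (auto simp: marked_order_polytope_def ties_def inner_diff_left inner_axis')
  then show ?thesis
    unfolding as_Inter
    by (intro face_of_Inter) (auto simp: face_of_refl convex_marked_order_polytope)
qed

lemma affine_tie_flat: "affine (tie_flat R M g s)"
  by (fastforce simp: affine_def tie_flat_def ties_subset_iff simp flip: distrib_right)

lemma subspace_tie_flat: "subspace (tie_flat R M (\<lambda>_. 0) s)"
  by (rule subspaceI) (fastforce simp: tie_flat_def ties_subset_iff)+

lemma tie_flat_eq_translation:
  assumes "s \<in> tie_flat R M g s"
  shows "tie_flat R M g s = (+) s ` tie_flat R M (\<lambda>_. 0) s"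
proof (intro subset_antisym subsetI)
  fix x assume "x \<in> tie_flat R M g s"
  then have "x - s \<in> tie_flat R M (\<lambda>_. 0) s"
    using assms by (auto simp: tie_flat_def ties_def)
  then show "x \<in> (+) s ` tie_flat R M (\<lambda>_. 0) s"
    by (rule rev_image_eqI) simp
qed (use assms in \<open>auto simp: tie_flat_def ties_def\<close>)

lemma mem_tie_flat_self:
  "s \<in> marked_order_polytope R M g \<Longrightarrow> s \<in> tie_flat R M g s"
  by (simp add: tie_flat_def marked_order_polytope_def)

lemma tie_face_subset_tie_flat: "tie_face R M g s \<subseteq> tie_flat R M g s"
  by (auto simp: tie_face_def tie_flat_def marked_order_polytope_def)

lemma tie_flat_locally_subset_tie_face:
  assumes "s \<in> marked_order_polytope R M g"
  obtains U where "open U" "s \<in> U" "tie_flat R M g s \<inter> U \<subseteq> tie_face R M g s"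
proof
  define U :: "(real ^ 'a) set" where "U = (\<Inter>e\<in>R - ties R s. {x. x $ snd e < x $ fst e})"
  show "open U"
    unfolding U_def
    by (intro open_INT) (auto intro!: open_Collect_less continuous_intros)
  show "s \<in> U"
    using assms by (fastforce simp: U_def marked_order_polytope_def ties_def)
  show "tie_flat R M g s \<inter> U \<subseteq> tie_face R M g s"
  proof
    fix x assume x: "x \<in> tie_flat R M g s \<inter> U"
    have "x $ q \<le> x $ p" if "(p, q) \<in> R" for p q
    proof (cases "(p, q) \<in> ties R s")
      case True
      then show ?thesis using x by (auto simp: tie_flat_def ties_def)
    next
      case False
      then show ?thesis using x that by (force simp: U_def)
    qed
    then show "x \<in> tie_face R M g s"
      using x by (auto simp: tie_face_def tie_flat_def marked_order_polytope_def)
  qed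
qed

lemma affine_hull_tie_face:
  assumes "s \<in> marked_order_polytope R M g"
  shows "affine hull tie_face R M g s = tie_flat R M g s"
proof
  show "affine hull tie_face R M g s \<subseteq> tie_flat R M g s"
    by (simp add: hull_minimal tie_face_subset_tie_flat affine_tie_flat)
  obtain U where U: "open U" "s \<in> U" "tie_flat R M g s \<inter> U \<subseteq> tie_face R M g s"
    using tie_flat_locally_subset_tie_face[OF assms] .
  then have "affine hull (tie_flat R M g s \<inter> U) = tie_flat R M g s"
    using mem_tie_flat_self[OF assms]
    by (subst affine_hull_affine_Int_open) (auto simp: affine_tie_flat hull_same)
  then show "tie_flat R M g s \<subseteq> affine hull tie_face R M g s"
    using hull_mono[OF U(3)] by metis
qed

lemma mem_rel_interior_tie_face:
  assumes "s \<in> marked_order_polytope R M g"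
  shows "s \<in> rel_interior (tie_face R M g s)"
proof -
  obtain U where "open U" "s \<in> U" "tie_flat R M g s \<inter> U \<subseteq> tie_face R M g s"
    using tie_flat_locally_subset_tie_face[OF assms] .
  moreover have "s \<in> tie_face R M g s"
    using assms by (simp add: tie_face_def)
  ultimately show ?thesis
    unfolding mem_rel_interior affine_hull_tie_face[OF assms] by blast
qed

lemma aff_dim_tie_face:
  assumes "s \<in> marked_order_polytope R M g"
  shows "aff_dim (tie_face R M g s) = int (dim (tie_flat R M (\<lambda>_. 0) s))"
proof -
  have "aff_dim (tie_face R M g s) = aff_dim (tie_flat R M g s)"
    using aff_dim_affine_hull[of "tie_face R M g s"] by (simp add: affine_hull_tie_face[OF assms])
  also have "\<dots> = aff_dim (tie_flat R M (\<lambda>_. 0) s)"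
    using tie_flat_eq_translation[OF mem_tie_flat_self[OF assms]]
    by (simp add: aff_dim_translation_eq)
  also have "\<dots> = int (dim (tie_flat R M (\<lambda>_. 0) s))"
    by (rule aff_dim_subspace[OF subspace_tie_flat])
  finally show ?thesis .
qed

lemma tie_face_eq_iff:
  assumes "s \<in> marked_order_polytope R M g" "s' \<in> marked_order_polytope R M g"
  shows "tie_face R M g s = tie_face R M g s' \<longleftrightarrow> ties R s = ties R s'"
  using assms by (auto simp: tie_face_def)

lemma face_of_marked_order_polytope_eq_tie_face:
  assumes "f face_of marked_order_polytope R M g" "s \<in> rel_interior f"
  shows "s \<in> marked_order_polytope R M g" "f = tie_face R M g s"
proof -
  show "s \<in> marked_order_polytope R M g"
    using assms face_of_imp_subset rel_interior_subset by blast
  then show "f = tie_face R M g s"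
    using face_of_eq[OF assms(1) tie_face_face_of] mem_rel_interior_tie_face assms(2) by blast
qed

lemma faces_marked_order_polytope:
  "{f. f face_of marked_order_polytope R M g \<and> f \<noteq> {}} =
    tie_face R M g ` marked_order_polytope R M g"
proof (intro subset_antisym subsetI)
  fix f assume "f \<in> {f. f face_of marked_order_polytope R M g \<and> f \<noteq> {}}"
  then have f: "f face_of marked_order_polytope R M g" "f \<noteq> {}"
    by auto
  then obtain s where "s \<in> rel_interior f"
    using face_of_imp_convex rel_interior_eq_empty by blast
  then show "f \<in> tie_face R M g ` marked_order_polytope R M g"
    using face_of_marked_order_polytope_eq_tie_face[OF f(1)] by blast
next
  fix f assume "f \<in> tie_face R M g ` marked_order_polytope R M g"
  then show "f \<in> {f. f face_of marked_order_polytope R M g \<and> f \<noteq> {}}"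
    using tie_face_face_of mem_rel_interior_tie_face rel_interior_subset by blast
qed

lemma rel_interior_tie_faceD:
  assumes "s \<in> marked_order_polytope R M g" "x \<in> rel_interior (tie_face R M g s)"
  shows "x \<in> marked_order_polytope R M g" "ties R x = ties R s"
  using face_of_marked_order_polytope_eq_tie_face[OF tie_face_face_of assms(2)]
    tie_face_eq_iff[OF assms(1)] by blast+

lemma dim_eq_card_coordinates:
  fixes S :: "(real ^ 'i) set"
  assumes "subspace S"
    and inj: "\<And>v. v \<in> S \<Longrightarrow> (\<And>p. p \<in> M \<Longrightarrow> v $ p = 0) \<Longrightarrow> v = 0"
    and surj: "\<And>x. \<exists>v\<in>S. \<forall>p\<in>M. v $ p = x p"
  shows "dim S = card M"
proof -
  define f :: "real ^ 'i \<Rightarrow> real ^ 'i" where "f v = (\<chi> p. if p \<in> M then v $ p else 0)" for v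
  have "linear f"
    by (rule linearI) (auto simp: f_def vec_eq_iff)
  have "v = 0" if "v \<in> S" "f v = 0" for v
    using that inj[of v] by (auto simp: f_def vec_eq_iff split: if_splits)
  then have "inj_on f S"
    using linear_injective_on_subspace_0[OF \<open>linear f\<close> \<open>subspace S\<close>] by blast
  then have "dim S = dim (f ` S)"
    using \<open>linear f\<close>
    by (intro dim_image_eq[symmetric]) (simp_all add: span_eq_iff[THEN iffD2, OF \<open>subspace S\<close>])
  also have "f ` S = {x. \<forall>p. p \<notin> M \<longrightarrow> x $ p = 0}"
  proof (intro subset_antisym subsetI)
    fix x :: "real ^ 'i" assume x: "x \<in> {x. \<forall>p. p \<notin> M \<longrightarrow> x $ p = 0}"
    obtain v where "v \<in> S" "\<forall>p\<in>M. v $ p = x $ p"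
      using surj by blast
    moreover from this have "f v = x"
      using x by (auto simp: f_def vec_eq_iff)
    ultimately show "x \<in> f ` S" by blast
  qed (auto simp: f_def)
  also have "dim \<dots> = card M"
    using dim_substandard_cart[of M, where 'a = real] by (simp add: dim_vec_eq)
  finally show ?thesis .
qed

subsection \<open>Gelfand--Tsetlin arrays\<close>

text \<open>
  The cell \<open>(i, j)\<close> stands for the entry \<open>(i + 1, j)\<close> and its upper neighbours \<open>(i, j)\<close> and
  \<open>(i, j + 1)\<close>.
\<close>

definition cells :: "nat \<Rightarrow> (nat \<times> nat) set" where
  "cells n = {(i, j). 1 \<le> j \<and> i + j < n}"

lemma mem_cells_iff [simp]: "(i, j) \<in> cells n \<longleftrightarrow> 1 \<le> j \<and> i + j < n"
  by (simp add: cells_def)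

lemma gt_pos_gt_at:
  assumes "1 \<le> j" "i + j \<le> CARD('n::finite)"
  shows "gt_pos (gt_at (i, j) :: 'n gt_index) = (i, j)"
  using assms by (intro gt_at_inverse) auto

lemma gt_index_cases:
  fixes p :: "'n::finite gt_index"
  obtains i j where "1 \<le> j" "i + j \<le> CARD('n)" "p = gt_at (i, j)"
proof
  show "1 \<le> snd (gt_pos p)" "fst (gt_pos p) + snd (gt_pos p) \<le> CARD('n)"
    using gt_pos[of p] by auto
  show "p = gt_at (fst (gt_pos p), snd (gt_pos p))"
    by (simp add: gt_pos_inverse)
qed

lemma array_eqI:
  fixes s s' :: "real ^ ('n::finite) gt_index"
  assumes "\<And>i j. 1 \<le> j \<Longrightarrow> i + j \<le> CARD('n) \<Longrightarrow> entry s i j = entry s' i j"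
  shows "s = s'"
  unfolding vec_eq_iff
proof
  fix p :: "'n gt_index"
  show "s $ p = s' $ p"
    by (cases p rule: gt_index_cases) (use assms in \<open>simp add: entry_def\<close>)
qed

definition array_of :: "(nat \<Rightarrow> nat \<Rightarrow> real) \<Rightarrow> real ^ ('n::finite) gt_index" where
  "array_of f = (\<chi> p. case gt_pos p of (i, j) \<Rightarrow> f i j)"

lemma entry_array_of:
  assumes "1 \<le> j" "i + j \<le> CARD('n::finite)"
  shows "entry (array_of f :: real ^ 'n gt_index) i j = f i j"
  using assms by (simp add: entry_def array_of_def gt_pos_gt_at del: One_nat_def)

definition interlacing :: "real ^ ('n::finite) gt_index \<Rightarrow> bool" where
  "interlacing s \<longleftrightarrow> (\<forall>i j. (i, j) \<in> cells CARD('n) \<longrightarrow>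
     entry s (Suc i) j \<le> entry s i j \<and> entry s i (Suc j) \<le> entry s (Suc i) j)"

lemma interlacing_cell:
  fixes s :: "real ^ ('n::finite) gt_index"
  assumes "interlacing s" "1 \<le> j" "i + j < CARD('n)"
  shows "entry s (Suc i) j \<le> entry s i j" "entry s i (Suc j) \<le> entry s (Suc i) j"
  using assms by (auto simp: interlacing_def)

definition top_row :: "('n::finite) gt_index set" where
  "top_row = {p. fst (gt_pos p) = 0}"

definition gt_order :: "(('n::finite) gt_index \<times> 'n gt_index) set" where
  "gt_order = (\<Union>(i, j)\<in>cells CARD('n).
     {(gt_at (i, j), gt_at (Suc i, j)), (gt_at (Suc i, j), gt_at (i, Suc j))})"

definition gt_marking :: "(nat \<Rightarrow> real) \<Rightarrow> ('n::finite) gt_index \<Rightarrow> real" where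
  "gt_marking g p = g (snd (gt_pos p))"

abbreviation gt_polytope :: "(nat \<Rightarrow> real) \<Rightarrow> (real ^ ('n::finite) gt_index) set" where
  "gt_polytope g \<equiv> marked_order_polytope gt_order top_row (gt_marking g)"

abbreviation gt_face ::
    "(nat \<Rightarrow> real) \<Rightarrow> real ^ ('n::finite) gt_index \<Rightarrow> (real ^ 'n gt_index) set" where
  "gt_face g \<equiv> tie_face gt_order top_row (gt_marking g)"

abbreviation gt_flat ::
    "(nat \<Rightarrow> real) \<Rightarrow> real ^ ('n::finite) gt_index \<Rightarrow> (real ^ 'n gt_index) set" where
  "gt_flat g \<equiv> tie_flat gt_order top_row (gt_marking g)"

lemma Ball_gt_order:
  "(\<forall>(p, q)\<in>(gt_order :: (('n::finite) gt_index \<times> 'n gt_index) set). P p q) \<longleftrightarrow>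
    (\<forall>i j. (i, j) \<in> cells CARD('n) \<longrightarrow>
      P (gt_at (i, j)) (gt_at (Suc i, j)) \<and> P (gt_at (Suc i, j)) (gt_at (i, Suc j)))"
  unfolding gt_order_def by fast

lemma Ball_top_row:
  "(\<forall>p\<in>(top_row :: ('n::finite) gt_index set). s $ p = gt_marking g p) \<longleftrightarrow>
    (\<forall>j\<in>{1..CARD('n)}. entry s 0 j = g j)"
proof (intro iffI ballI)
  fix j assume "\<forall>p\<in>top_row. s $ p = gt_marking g p" "j \<in> {1..CARD('n)}"
  then show "entry s 0 j = g j"
    by (auto simp: top_row_def gt_marking_def entry_def gt_pos_gt_at
        dest: bspec[where x = "gt_at (0, j)"])
next
  fix p :: "'n gt_index" assume "\<forall>j\<in>{1..CARD('n)}. entry s 0 j = g j" "p \<in> top_row"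
  then show "s $ p = gt_marking g p"
    by (cases p rule: gt_index_cases) (auto simp: top_row_def gt_marking_def entry_def gt_pos_gt_at)
qed

lemma gt_marking_zero: "gt_marking (\<lambda>_. 0) = (\<lambda>_. 0)"
  by (simp add: gt_marking_def fun_eq_iff)

lemma mem_gt_polytope_iff:
  fixes s :: "real ^ ('n::finite) gt_index"
  shows "s \<in> gt_polytope g \<longleftrightarrow> (\<forall>j\<in>{1..CARD('n)}. entry s 0 j = g j) \<and> interlacing s"
  by (simp add: marked_order_polytope_def Ball_top_row Ball_gt_order interlacing_def entry_def)

lemma mem_gt_flat_iff:
  fixes s x :: "real ^ ('n::finite) gt_index"
  shows "x \<in> gt_flat g s \<longleftrightarrow> (\<forall>j\<in>{1..CARD('n)}. entry x 0 j = g j) \<and>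
    (\<forall>i j. (i, j) \<in> cells CARD('n) \<longrightarrow>
      (entry s (Suc i) j = entry s i j \<longrightarrow> entry x (Suc i) j = entry x i j) \<and>
      (entry s (Suc i) j = entry s i (Suc j) \<longrightarrow> entry x (Suc i) j = entry x i (Suc j)))"
  by (auto simp: tie_flat_def Ball_top_row ties_subset_iff Ball_gt_order entry_def)

lemma gt_flat_cell:
  fixes s x :: "real ^ ('n::finite) gt_index"
  assumes "x \<in> gt_flat g s" "1 \<le> j" "i + j < CARD('n)"
  shows "entry s (Suc i) j = entry s i j \<Longrightarrow> entry x (Suc i) j = entry x i j"
    and "entry s (Suc i) j = entry s i (Suc j) \<Longrightarrow> entry x (Suc i) j = entry x i (Suc j)"
  using assms by (simp_all add: mem_gt_flat_iff)

lemma ties_gt_order_eq_iff: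
  fixes s s' :: "real ^ ('n::finite) gt_index"
  shows "ties gt_order s = ties gt_order s' \<longleftrightarrow> (\<forall>i j. (i, j) \<in> cells CARD('n) \<longrightarrow>
    (entry s (Suc i) j = entry s i j \<longleftrightarrow> entry s' (Suc i) j = entry s' i j) \<and>
    (entry s (Suc i) j = entry s i (Suc j) \<longleftrightarrow> entry s' (Suc i) j = entry s' i (Suc j)))"
  unfolding set_eq_subset ties_subset_iff Ball_gt_order entry_def[symmetric]
    eq_commute[of "entry x i (Suc j)" "entry x (Suc i) j" for x i j]
  by blast

lemma GT_polytope_eq_gt_polytope:
  "(GT_polytope a :: (real ^ ('n::finite) gt_index) set) =
    gt_polytope (\<lambda>j. real (weight_coord CARD('n) a j))"
proof -
  have last: "weight_coord CARD('n) a CARD('n) = 0"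
    by (simp add: weight_coord_def)
  have "{1..CARD('n)} = insert CARD('n) {1..CARD('n) - 1}"
    by (auto simp: Suc_le_eq)
  then have top: "(\<forall>j\<in>{1..CARD('n)}. P j) \<longleftrightarrow> (\<forall>j\<in>{1..CARD('n) - 1}. P j) \<and> P CARD('n)" for P
    by auto
  have cell: "(i, j) \<in> cells CARD('n) \<longleftrightarrow>
      i + 1 \<le> CARD('n) - 1 \<and> 1 \<le> j \<and> j \<le> CARD('n) - (i + 1)" for i j
    by auto
  show ?thesis
    unfolding set_eq_iff mem_gt_polytope_iff top interlacing_def
    by (auto simp: GT_polytope_def last cell simp del: mem_cells_iff)
qed

subsection \<open>Dimensions of faces and midpoint arrays\<close>

definition free_cells :: "real ^ ('n::finite) gt_index \<Rightarrow> (nat \<times> nat) set" where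
  "free_cells s = {(i, j) \<in> cells CARD('n).
     entry s (Suc i) j \<noteq> entry s i j \<and> entry s (Suc i) j \<noteq> entry s i (Suc j)}"

lemma free_cells_cong:
  assumes "ties gt_order s = ties gt_order s'"
  shows "free_cells s = free_cells s'"
  using assms unfolding ties_gt_order_eq_iff free_cells_def by blast

lemma gt_flat_eqI:
  fixes x y :: "real ^ ('n::finite) gt_index"
  assumes flat: "x \<in> gt_flat g s" "y \<in> gt_flat g s"
    and free: "\<And>i j. (i, j) \<in> free_cells s \<Longrightarrow> entry x i j = entry y i j \<Longrightarrow>
      entry x i (Suc j) = entry y i (Suc j) \<Longrightarrow> entry x (Suc i) j = entry y (Suc i) j"
  shows "x = y"
proof (rule array_eqI)
  show "entry x i j = entry y i j" if "1 \<le> j" "i + j \<le> CARD('n)" for i j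
    using that
  proof (induction i arbitrary: j)
    case 0
    then show ?case using flat by (simp add: mem_gt_flat_iff)
  next
    case (Suc i)
    then have cell: "(i, j) \<in> cells CARD('n)"
      and upper: "entry x i j = entry y i j" "entry x i (Suc j) = entry y i (Suc j)"
      by simp_all
    show ?case
    proof (cases "(i, j) \<in> free_cells s")
      case False
      then have "entry s (Suc i) j = entry s i j \<or> entry s (Suc i) j = entry s i (Suc j)"
        using cell by (simp add: free_cells_def)
      then show ?thesis
        using cell upper gt_flat_cell[OF flat(1)] gt_flat_cell[OF flat(2)] by auto
    qed (rule free[OF _ upper])
  qed
qed

fun tie_extension :: "real ^ ('n::finite) gt_index \<Rightarrow> (nat \<Rightarrow> real) \<Rightarrow>
    (nat \<Rightarrow> nat \<Rightarrow> real \<Rightarrow> real \<Rightarrow> real) \<Rightarrow> nat \<Rightarrow> nat \<Rightarrow> real" where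
  "tie_extension s g c 0 j = g j"
| "tie_extension s g c (Suc i) j =
    (if entry s (Suc i) j = entry s i j then tie_extension s g c i j
     else if entry s (Suc i) j = entry s i (Suc j) then tie_extension s g c i (Suc j)
     else c i j (tie_extension s g c i j) (tie_extension s g c i (Suc j)))"

lemma tie_extension_adjacent_eq:
  fixes s :: "real ^ ('n::finite) gt_index"
  assumes s: "interlacing s"
    and g: "\<And>j. 1 \<le> j \<Longrightarrow> j < CARD('n) \<Longrightarrow> entry s 0 j = entry s 0 (Suc j) \<Longrightarrow> g j = g (Suc j)"
    and "1 \<le> j" "i + j < CARD('n)" "entry s i j = entry s i (Suc j)"
  shows "tie_extension s g c i j = tie_extension s g c i (Suc j)"
  using assms(3-)
proof (induction i arbitrary: j)
  case 0
  then show ?case using g by simp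
next
  case (Suc i)
  have "entry s i (Suc j) \<le> entry s (Suc i) j" "entry s (Suc i) (Suc j) \<le> entry s i (Suc j)"
    using interlacing_cell[OF s] Suc.prems(1,2) by simp_all
  then have "entry s (Suc i) j = entry s i (Suc j)" "entry s (Suc i) (Suc j) = entry s i (Suc j)"
    using Suc.prems(3) by auto
  then show ?case using Suc by simp
qed

lemma exists_tie_extension:
  fixes s :: "real ^ ('n::finite) gt_index"
  assumes s: "interlacing s"
    and g: "\<And>j. 1 \<le> j \<Longrightarrow> j < CARD('n) \<Longrightarrow> entry s 0 j = entry s 0 (Suc j) \<Longrightarrow> g j = g (Suc j)"
  obtains x where "x \<in> gt_flat g s"
    and "\<And>i j. (i, j) \<in> free_cells s \<Longrightarrow> entry x (Suc i) j = c i j (entry x i j) (entry x i (Suc j))"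
proof
  let ?b = "tie_extension s g c"
  define x :: "real ^ 'n gt_index" where "x = array_of ?b"
  have x: "entry x i j = ?b i j" if "1 \<le> j" "i + j \<le> CARD('n)" for i j
    using that by (simp add: x_def entry_array_of)
  have "entry x (Suc i) j = entry x i j"
    if "1 \<le> j" "i + j < CARD('n)" "entry s (Suc i) j = entry s i j" for i j
    using that by (simp add: x)
  moreover have "entry x (Suc i) j = entry x i (Suc j)"
    if "1 \<le> j" "i + j < CARD('n)" "entry s (Suc i) j = entry s i (Suc j)" for i j
  proof (cases "entry s (Suc i) j = entry s i j")
    case True
    then have "?b i j = ?b i (Suc j)"
      by (intro tie_extension_adjacent_eq[OF s]) (use g that in auto)
    then show ?thesis using that True by (simp add: x)
  qed (use that in \<open>simp add: x\<close>)
  ultimately show "x \<in> gt_flat g s"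
    by (auto simp: mem_gt_flat_iff) (simp add: x)
  show "entry x (Suc i) j = c i j (entry x i j) (entry x i (Suc j))"
    if "(i, j) \<in> free_cells s" for i j
    using that by (auto simp: free_cells_def x)
qed

lemma dim_gt_flat:
  fixes s :: "real ^ ('n::finite) gt_index"
  assumes s: "interlacing s"
  shows "dim (tie_flat gt_order top_row (\<lambda>_. 0) s) = card (free_cells s)"
proof -
  let ?V = "gt_flat (\<lambda>_. 0) s"
  have "subspace ?V"
    unfolding gt_marking_zero by (rule subspace_tie_flat)
  let ?at = "\<lambda>(i, j). gt_at (Suc i, j) :: 'n gt_index"
  have free: "1 \<le> j" "i + j < CARD('n)" if "(i, j) \<in> free_cells s" for i j
    using that by (auto simp: free_cells_def)
  have "dim ?V = card (?at ` free_cells s)"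
  proof (rule dim_eq_card_coordinates[OF \<open>subspace ?V\<close>])
    fix v assume v: "v \<in> ?V" "\<And>p. p \<in> ?at ` free_cells s \<Longrightarrow> v $ p = 0"
    then have "entry v (Suc i) j = 0" if "(i, j) \<in> free_cells s" for i j
      using that by (force simp: entry_def)
    then show "v = 0"
      using v(1) subspace_0[OF \<open>subspace ?V\<close>] by (intro gt_flat_eqI) (auto simp: entry_def)
  next
    fix x :: "'n gt_index \<Rightarrow> real"
    obtain v where "v \<in> ?V"
      "\<And>i j. (i, j) \<in> free_cells s \<Longrightarrow> entry v (Suc i) j = x (gt_at (Suc i, j))"
      by (rule exists_tie_extension[OF s, of "\<lambda>_. 0" "\<lambda>i j _ _. x (gt_at (Suc i, j))"]) auto
    then show "\<exists>v\<in>?V. \<forall>p\<in>?at ` free_cells s. v $ p = x p"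
      by (force simp: entry_def)
  qed
  also have "\<dots> = card (free_cells s)"
  proof (intro card_image inj_onI)
    fix p q assume pq: "p \<in> free_cells s" "q \<in> free_cells s" "?at p = ?at q"
    then have "gt_pos (?at p) = gt_pos (?at q)" by simp
    then show "p = q"
      using pq(1,2) free by (auto simp: gt_pos_gt_at Suc_le_eq split: prod.splits)
  qed
  finally show ?thesis by (simp add: gt_marking_zero)
qed

definition midpoint_arrays :: "(nat \<Rightarrow> real) \<Rightarrow> (real ^ ('n::finite) gt_index) set" where
  "midpoint_arrays g = {s. (\<forall>j\<in>{1..CARD('n)}. entry s 0 j = g j) \<and>
     (\<forall>i j. (i, j) \<in> cells CARD('n) \<longrightarrow>
       entry s (Suc i) j \<in> cell_points (entry s i j) (entry s i (Suc j)))}"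

lemma midpoint_arrays_subset_gt_polytope:
  assumes g: "antimono_on {1..CARD('n::finite)} g"
  shows "midpoint_arrays g \<subseteq> (gt_polytope g :: (real ^ 'n gt_index) set)"
proof
  fix s :: "real ^ 'n gt_index" assume s: "s \<in> midpoint_arrays g"
  have between: "entry s i (Suc j) \<le> entry s (Suc i) j \<and> entry s (Suc i) j \<le> entry s i j"
    if "entry s i (Suc j) \<le> entry s i j" "1 \<le> j" "i + j < CARD('n)" for i j
  proof -
    have "entry s (Suc i) j \<in> cell_points (entry s i j) (entry s i (Suc j))"
      using s that(2,3) by (simp add: midpoint_arrays_def)
    then show ?thesis using cell_points_between that(1) by blast
  qed
  have "entry s i (Suc j) \<le> entry s i j" if "1 \<le> j" "i + j < CARD('n)" for i j
    using that
  proof (induction i arbitrary: j)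
    case 0
    then show ?case
      using s g by (auto simp: midpoint_arrays_def intro: monotone_onD)
  next
    case (Suc i)
    then show ?case
      using between[of i j] between[of i "Suc j"] by force
  qed
  then have "interlacing s"
    using between by (auto simp: interlacing_def)
  then show "s \<in> gt_polytope g"
    using s by (simp add: mem_gt_polytope_iff midpoint_arrays_def)
qed

lemma midpoint_arrays_ties_inject:
  fixes s s' :: "real ^ ('n::finite) gt_index"
  assumes "s \<in> midpoint_arrays g" "s' \<in> midpoint_arrays g" "ties gt_order s = ties gt_order s'"
  shows "s = s'"
proof (rule gt_flat_eqI)
  show "s \<in> gt_flat g s" "s' \<in> gt_flat g s"
    using assms by (auto simp: tie_flat_def Ball_top_row midpoint_arrays_def)
  fix i j
  assume free: "(i, j) \<in> free_cells s"
    and upper: "entry s i j = entry s' i j" "entry s i (Suc j) = entry s' i (Suc j)"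
  from free have "(i, j) \<in> free_cells s'"
    using free_cells_cong[OF assms(3)] by simp
  then show "entry s (Suc i) j = entry s' (Suc i) j"
    using assms(1,2) free upper by (force simp: midpoint_arrays_def cell_points_def free_cells_def)
qed

definition midpoint_filling :: "real ^ ('n::finite) gt_index \<Rightarrow> real ^ 'n gt_index \<Rightarrow> bool" where
  "midpoint_filling s x \<longleftrightarrow> (\<forall>i j. (i, j) \<in> free_cells s \<longrightarrow>
     entry x (Suc i) j = (entry x i j + entry x i (Suc j)) / 2)"

text \<open>
  Filling the free cells with midpoints creates no new ties: a strict inequality between
  neighbours in one row of \<open>s\<close> persists in the row of \<open>x\<close>, by induction on the row.
\<close>

lemma midpoint_filling_cell:
  fixes s x :: "real ^ ('n::finite) gt_index"
  assumes s: "interlacing s" and x: "x \<in> gt_flat g s" and mid: "midpoint_filling s x"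
    and less: "entry s i (Suc j) < entry s i j \<Longrightarrow> entry x i (Suc j) < entry x i j"
    and cell: "1 \<le> j" "i + j < CARD('n)"
  shows "entry x i (Suc j) \<le> entry x (Suc i) j" "entry x (Suc i) j \<le> entry x i j"
    and "entry x (Suc i) j = entry x i j \<longleftrightarrow> entry s (Suc i) j = entry s i j"
    and "entry x (Suc i) j = entry x i (Suc j) \<longleftrightarrow> entry s (Suc i) j = entry s i (Suc j)"
proof -
  have "entry x i (Suc j) \<le> entry x (Suc i) j \<and> entry x (Suc i) j \<le> entry x i j \<and>
      (entry x (Suc i) j = entry x i j \<longleftrightarrow> entry s (Suc i) j = entry s i j) \<and>
      (entry x (Suc i) j = entry x i (Suc j) \<longleftrightarrow> entry s (Suc i) j = entry s i (Suc j))"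
  proof (cases "entry s i (Suc j) < entry s i j")
    case True
    consider "entry s (Suc i) j = entry s i j" "entry x (Suc i) j = entry x i j"
      | "entry s (Suc i) j = entry s i (Suc j)" "entry x (Suc i) j = entry x i (Suc j)"
      | "(i, j) \<in> free_cells s" "entry x (Suc i) j = (entry x i j + entry x i (Suc j)) / 2"
      using gt_flat_cell[OF x cell] cell mid unfolding midpoint_filling_def
      by (auto simp: free_cells_def)
    then show ?thesis
      using less[OF True] True by cases (auto simp: free_cells_def)
  next
    case False
    then have "entry s (Suc i) j = entry s i j" "entry s (Suc i) j = entry s i (Suc j)"
      using interlacing_cell[OF s cell] by auto
    moreover from this have
      "entry x (Suc i) j = entry x i j" "entry x (Suc i) j = entry x i (Suc j)"
      by (blast intro: gt_flat_cell[OF x cell])+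
    ultimately show ?thesis by simp
  qed
  then show "entry x i (Suc j) \<le> entry x (Suc i) j" "entry x (Suc i) j \<le> entry x i j"
    "entry x (Suc i) j = entry x i j \<longleftrightarrow> entry s (Suc i) j = entry s i j"
    "entry x (Suc i) j = entry x i (Suc j) \<longleftrightarrow> entry s (Suc i) j = entry s i (Suc j)"
    by simp_all
qed

lemma midpoint_filling_less:
  fixes s x :: "real ^ ('n::finite) gt_index"
  assumes s: "s \<in> gt_polytope g" and x: "x \<in> gt_flat g s" and mid: "midpoint_filling s x"
    and "1 \<le> j" "i + j < CARD('n)" "entry s i (Suc j) < entry s i j"
  shows "entry x i (Suc j) < entry x i j"
  using assms(4-)
proof (induction i arbitrary: j)
  case 0
  then show ?case using s x by (simp add: mem_gt_polytope_iff mem_gt_flat_iff)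
next
  case (Suc i)
  have "interlacing s" using s by (simp add: mem_gt_polytope_iff)
  note cell = midpoint_filling_cell[OF this x mid Suc.IH]
  have "entry x (Suc i) (Suc j) \<le> entry x i (Suc j)" "entry x i (Suc j) \<le> entry x (Suc i) j"
    using cell(2)[of "Suc j"] cell(1)[of j] Suc.prems by simp_all
  moreover have
    "entry x (Suc i) (Suc j) \<noteq> entry x i (Suc j) \<or> entry x (Suc i) j \<noteq> entry x i (Suc j)"
    using cell(3)[of "Suc j"] cell(4)[of j] Suc.prems by auto
  ultimately show ?case by linarith
qed

lemma exists_midpoint_array:
  fixes s :: "real ^ ('n::finite) gt_index"
  assumes "s \<in> gt_polytope g"
  obtains x :: "real ^ 'n gt_index"
  where "x \<in> midpoint_arrays g" "ties gt_order x = ties gt_order s"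
proof -
  have s: "interlacing s" and g: "\<And>j. 1 \<le> j \<Longrightarrow> j \<le> CARD('n) \<Longrightarrow> entry s 0 j = g j"
    using assms by (auto simp: mem_gt_polytope_iff)
  obtain x where x: "x \<in> gt_flat g s" and mid: "midpoint_filling s x"
    by (rule exists_tie_extension[OF s, of g "\<lambda>_ _ x y. (x + y) / 2"])
      (auto simp: g midpoint_filling_def)
  have "ties gt_order x = ties gt_order s"
    using midpoint_filling_cell(3,4)[OF s x mid midpoint_filling_less[OF assms x mid]]
    by (auto simp: ties_gt_order_eq_iff)
  moreover have "x \<in> midpoint_arrays g"
    using x mid unfolding midpoint_filling_def
    by (force simp: midpoint_arrays_def cell_points_def mem_gt_flat_iff free_cells_def)
  ultimately show thesis by (rule that[rotated])
qed

lemma bij_betw_midpoint_arrays_faces: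
  assumes "antimono_on {1..CARD('n::finite)} g"
  shows "bij_betw (gt_face g) (midpoint_arrays g)
    {f. f face_of (gt_polytope g :: (real ^ 'n gt_index) set) \<and> f \<noteq> {}}"
  unfolding bij_betw_def faces_marked_order_polytope
proof
  note mem = subsetD[OF midpoint_arrays_subset_gt_polytope[OF assms]]
  show "inj_on (gt_face g) (midpoint_arrays g :: (real ^ 'n gt_index) set)"
    using tie_face_eq_iff[OF mem mem] midpoint_arrays_ties_inject by (intro inj_onI) blast
  have "gt_face g s \<in> gt_face g ` midpoint_arrays g"
    if s: "s \<in> gt_polytope g" for s :: "real ^ 'n gt_index"
  proof -
    obtain x where "x \<in> midpoint_arrays g" "ties gt_order x = ties gt_order s"
      by (rule exists_midpoint_array[OF s])
    then show ?thesis by (auto simp: tie_face_def)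
  qed
  then show "gt_face g ` midpoint_arrays g =
      gt_face g ` (gt_polytope g :: (real ^ 'n gt_index) set)"
    using mem by blast
qed

subsection \<open>Rows of an array\<close>

definition gt_row :: "real ^ ('n::finite) gt_index \<Rightarrow> nat \<Rightarrow> real list" where
  "gt_row s i = map (entry s i) [1..<Suc (CARD('n) - i)]"

lemma length_gt_row [simp]: "length (gt_row (s :: real ^ ('n::finite) gt_index) i) = CARD('n) - i"
  by (simp add: gt_row_def del: upt_Suc)

lemma nth_gt_row [simp]:
  fixes s :: "real ^ ('n::finite) gt_index"
  assumes "j < CARD('n) - i"
  shows "gt_row s i ! j = entry s i (Suc j)"
  using assms by (simp add: gt_row_def del: upt_Suc)

lemma row_mult_eq_count_list: "row_mult s i x = count_list (gt_row s i) x"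
  by (simp add: row_mult_def gt_row_def count_list_map_distinct atLeastLessThanSuc_atLeastAtMost
      del: upt_Suc)

lemma array_weight_eq_prod_row_weight:
  fixes s :: "real ^ ('n::finite) gt_index"
  shows "array_weight s = (\<Prod>i<CARD('n) - 1. row_weight t_var (gt_row s i) (gt_row s (Suc i)))"
proof -
  let ?I = "{1..CARD('n) - 1}"
  define X where "X i = {x. row_mult s i x = Suc (row_mult s (i - 1) x)}" for i
  define m where "m = (\<lambda>(i, x). row_mult s i x)"
  have "X i \<subseteq> set (gt_row s i)" for i
    using count_notin by (fastforce simp: X_def row_mult_eq_count_list)
  then have fin: "finite (X i)" for i
    using finite_subset by blast
  have d_number: "d_number s l = card {e \<in> Sigma ?I X. m e = l}" if "l \<in> ?I" for l
    unfolding d_number_def using that by (intro arg_cong[where f = card]) (auto simp: X_def m_def)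
  have "row_mult s i x \<in> ?I" if "i \<in> ?I" "x \<in> X i" for i x
    using that count_le_length[of "gt_row s i" x] by (auto simp: X_def row_mult_eq_count_list)
  then have range: "m ` Sigma ?I X \<subseteq> ?I"
    by (auto simp: m_def)
  have "array_weight s = (\<Prod>l\<in>?I. \<Prod>e | e \<in> Sigma ?I X \<and> m e = l. 1 - t_var ^ m e)"
    by (simp add: array_weight_def d_number)
  also have "\<dots> = (\<Prod>e\<in>Sigma ?I X. 1 - t_var ^ m e)"
    by (rule prod.group[OF _ _ range]) (simp_all add: fin)
  also have "\<dots> = (\<Prod>i\<in>?I. \<Prod>x\<in>X i. 1 - t_var ^ row_mult s i x)"
    by (simp add: prod.Sigma fin m_def case_prod_unfold)
  also have "\<dots> = (\<Prod>i\<in>?I. row_weight t_var (gt_row s (i - 1)) (gt_row s i))"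
    by (simp add: row_weight_eq_prod_increments X_def row_mult_eq_count_list)
  finally show ?thesis
    by (simp add: prod.atLeast1_atMost_eq)
qed

text \<open>
  Two consecutive rows interleave to a single decreasing sequence, whose ties are the ties
  between the two rows.
\<close>

definition zigzag :: "real ^ ('n::finite) gt_index \<Rightarrow> nat \<Rightarrow> nat \<Rightarrow> real" where
  "zigzag s i k = entry s (if even k then i else Suc i) (Suc (k div 2))"

lemma gt_row_eq_map_zigzag:
  fixes s :: "real ^ ('n::finite) gt_index"
  shows "gt_row s i = map (zigzag s i) (map (\<lambda>j. 2 * j) [0..<CARD('n) - i])"
    and "gt_row s (Suc i) = map (zigzag s i) (map (\<lambda>j. Suc (2 * j)) [0..<CARD('n) - Suc i])"
  by (auto intro!: nth_equalityI simp: zigzag_def)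

lemma zigzag_Suc_le:
  fixes s :: "real ^ ('n::finite) gt_index"
  assumes "interlacing s" "k < 2 * (CARD('n) - Suc i)"
  shows "zigzag s i (Suc k) \<le> zigzag s i k"
  using interlacing_cell[OF assms(1), of "Suc (k div 2)" i] assms(2)
  by (auto simp: zigzag_def)

lemma zigzag_Suc_eq_iff:
  fixes s s' :: "real ^ ('n::finite) gt_index"
  assumes "ties gt_order s = ties gt_order s'" "k < 2 * (CARD('n) - Suc i)"
  shows "zigzag s i (Suc k) = zigzag s i k \<longleftrightarrow> zigzag s' i (Suc k) = zigzag s' i k"
proof -
  have "(i, Suc (k div 2)) \<in> cells CARD('n)"
    using assms(2) by auto
  then have tie: "entry s (Suc i) (Suc (k div 2)) = entry s i (Suc (k div 2)) \<longleftrightarrow>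
      entry s' (Suc i) (Suc (k div 2)) = entry s' i (Suc (k div 2))"
    "entry s i (Suc (Suc (k div 2))) = entry s (Suc i) (Suc (k div 2)) \<longleftrightarrow>
      entry s' i (Suc (Suc (k div 2))) = entry s' (Suc i) (Suc (k div 2))"
    using assms(1) unfolding ties_gt_order_eq_iff by metis+
  show ?thesis
    by (cases "even k") (simp_all add: zigzag_def tie)
qed

lemma row_weight_ties_cong:
  fixes s s' :: "real ^ ('n::finite) gt_index"
  assumes "interlacing s" "interlacing s'" "ties gt_order s = ties gt_order s'" "Suc i < CARD('n)"
  shows "row_weight t (gt_row s i) (gt_row s (Suc i)) =
    row_weight t (gt_row s' i) (gt_row s' (Suc i))"
  unfolding gt_row_eq_map_zigzag(2) gt_row_eq_map_zigzag(1)[of _ i]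
proof (rule row_weight_map_cong)
  let ?N = "2 * (CARD('n) - Suc i)"
  let ?A = "set (map (\<lambda>j. 2 * j) [0..<CARD('n) - i]) \<union>
    set (map (\<lambda>j. Suc (2 * j)) [0..<CARD('n) - Suc i])"
  fix a b assume "a \<in> ?A" "b \<in> ?A"
  then have "a \<le> ?N" "b \<le> ?N" by auto
  then show "zigzag s i a = zigzag s i b \<longleftrightarrow> zigzag s' i a = zigzag s' i b"
    by (rule decreasing_eq_iff_cong[rotated 3])
      (intro zigzag_Suc_le zigzag_Suc_eq_iff assms, assumption)+
qed

lemma array_weight_ties_cong:
  assumes "interlacing s" "interlacing s'" "ties gt_order s = ties gt_order s'"
  shows "array_weight s = array_weight s'"
  unfolding array_weight_eq_prod_row_weight
  by (rule prod.cong[OF refl], rule row_weight_ties_cong[OF assms]) simp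

lemma face_weight_gt_face:
  assumes "s \<in> gt_polytope g"
  shows "face_weight (gt_face g s) = array_weight s"
proof -
  define x where "x = (SOME x. x \<in> rel_interior (gt_face g s))"
  have "x \<in> rel_interior (gt_face g s)"
    unfolding x_def by (rule someI, rule mem_rel_interior_tie_face[OF assms])
  then have "x \<in> gt_polytope g" "ties gt_order x = ties gt_order s"
    using rel_interior_tie_faceD[OF assms] by auto
  then have "array_weight x = array_weight s"
    using assms by (intro array_weight_ties_cong) (auto simp: mem_gt_polytope_iff)
  then show ?thesis by (simp add: face_weight_def x_def)
qed

lemma card_free_cells:
  fixes s :: "real ^ ('n::finite) gt_index"
  shows "card (free_cells s) = (\<Sum>i<CARD('n) - 1. free_entries (gt_row s i) (gt_row s (Suc i)))"
proof -
  let ?free = "\<lambda>i. {j. j < CARD('n) - Suc i \<and> entry s (Suc i) (Suc j) \<noteq> entry s i (Suc j) \<and>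
      entry s (Suc i) (Suc j) \<noteq> entry s i (Suc (Suc j))}"
  have "bij_betw (\<lambda>(i, j). (i, Suc j)) (Sigma {..<CARD('n) - 1} ?free) (free_cells s)"
    by (rule bij_betw_byWitness[where f' = "\<lambda>(i, j). (i, j - 1)"]) (auto simp: free_cells_def)
  then have "card (free_cells s) = card (Sigma {..<CARD('n) - 1} ?free)"
    by (rule bij_betw_same_card[symmetric])
  also have "\<dots> = (\<Sum>i<CARD('n) - 1. card (?free i))"
    by (rule card_SigmaI) auto
  also have "\<dots> = (\<Sum>i<CARD('n) - 1. free_entries (gt_row s i) (gt_row s (Suc i)))"
    by (intro sum.cong refl, subst free_entries_eq_card) (auto intro!: arg_cong[where f = card])
  finally show ?thesis .
qed

definition gt_rows :: "real ^ ('n::finite) gt_index \<Rightarrow> real list list" where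
  "gt_rows s = map (gt_row s) [0..<CARD('n)]"

lemma walk_weight_gt_rows:
  fixes s :: "real ^ ('n::finite) gt_index"
  shows "walk_weight (signed_row_weight t_var) (gt_rows s) =
    (-1) ^ card (free_cells s) * array_weight s"
proof -
  have "walk_weight (signed_row_weight t_var) (gt_rows s) =
      (\<Prod>i<CARD('n) - 1. signed_row_weight t_var (gt_row s i) (gt_row s (Suc i)))"
    by (simp add: walk_weight_def gt_rows_def)
  also have "\<dots> = (-1) ^ card (free_cells s) * array_weight s"
    by (simp add: signed_row_weight_def prod.distrib card_free_cells array_weight_eq_prod_row_weight
        power_sum)
  finally show ?thesis .
qed

lemma gt_rows_inject:
  fixes s s' :: "real ^ ('n::finite) gt_index"
  shows "gt_rows s = gt_rows s' \<longleftrightarrow> s = s'"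
proof
  assume rows: "gt_rows s = gt_rows s'"
  show "s = s'"
  proof (rule array_eqI)
    fix i j assume ij: "1 \<le> j" "i + j \<le> CARD('n)"
    then have "gt_row s i ! (j - 1) = gt_row s' i ! (j - 1)"
      using rows by (simp add: gt_rows_def)
    then show "entry s i j = entry s' i j" using ij by simp
  qed
qed simp

lemma gt_row_Suc_mem_next_rows_iff:
  fixes s :: "real ^ ('n::finite) gt_index"
  assumes "Suc i < CARD('n)"
  shows "gt_row s (Suc i) \<in> next_rows (gt_row s i) \<longleftrightarrow> (\<forall>j. (i, j) \<in> cells CARD('n) \<longrightarrow>
    entry s (Suc i) j \<in> cell_points (entry s i j) (entry s i (Suc j)))"
proof -
  have "gt_row s i \<noteq> []"
    using assms by (simp flip: length_greater_0_conv)
  moreover have "(\<forall>j. (i, j) \<in> cells CARD('n) \<longrightarrow> P j) \<longleftrightarrow> (\<forall>j < CARD('n) - Suc i. P (Suc j))" for P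
  proof
    assume shifted: "\<forall>j < CARD('n) - Suc i. P (Suc j)"
    have "P j" if "1 \<le> j" "i + j < CARD('n)" for j
      using shifted[rule_format, of "j - 1"] that by simp
    then show "\<forall>j. (i, j) \<in> cells CARD('n) \<longrightarrow> P j" by simp
  qed simp
  ultimately show ?thesis
    using assms by (simp add: mem_next_rows_iff Suc_diff_Suc)
qed

lemma gt_rows_mem_walks_iff:
  fixes s :: "real ^ ('n::finite) gt_index"
  shows "gt_rows s \<in> walks next_rows (CARD('n) - 1) (map g [1..<Suc CARD('n)]) \<longleftrightarrow>
    s \<in> midpoint_arrays g"
proof -
  have "gt_row s 0 = map g [1..<Suc CARD('n)] \<longleftrightarrow> (\<forall>j\<in>{1..CARD('n)}. entry s 0 j = g j)"
    by (simp add: gt_row_def atLeastLessThanSuc_atLeastAtMost del: upt_Suc)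
  moreover have "(\<forall>i < CARD('n) - 1. \<forall>j. (i, j) \<in> cells CARD('n) \<longrightarrow> P i j) \<longleftrightarrow>
      (\<forall>i j. (i, j) \<in> cells CARD('n) \<longrightarrow> P i j)" for P
    by force
  then have "(\<forall>i < CARD('n) - 1. gt_row s (Suc i) \<in> next_rows (gt_row s i)) \<longleftrightarrow>
      (\<forall>i j. (i, j) \<in> cells CARD('n) \<longrightarrow>
        entry s (Suc i) j \<in> cell_points (entry s i j) (entry s i (Suc j)))"
    by (simp add: gt_row_Suc_mem_next_rows_iff del: mem_cells_iff)
  ultimately show ?thesis
    by (simp add: mem_walks_iff gt_rows_def midpoint_arrays_def del: mem_cells_iff upt_Suc)
qed

lemma walks_next_rows_in_range_gt_rows:
  assumes c: "c \<in> walks next_rows (CARD('n::finite) - 1) r" and r: "length r = CARD('n)"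
  shows "c \<in> range (gt_rows :: real ^ 'n gt_index \<Rightarrow> real list list)"
proof (rule range_eqI)
  have "length (c ! i) = CARD('n) - i" if "i < CARD('n)" for i
    using that
  proof (induction i)
    case 0
    then show ?case using c r by (simp add: mem_walks_iff)
  next
    case (Suc i)
    then have "length (c ! i) = CARD('n) - i" "c ! Suc i \<in> next_rows (c ! i)"
      using c by (auto simp: mem_walks_iff)
    moreover from this(1) have "c ! i \<noteq> []"
      using Suc.prems by auto
    ultimately show ?case by (auto simp: mem_next_rows_iff)
  qed
  moreover have "length c = CARD('n)"
    using c by (simp add: mem_walks_iff)
  ultimately show "c = gt_rows (array_of (\<lambda>i j. c ! i ! (j - 1)) :: real ^ 'n gt_index)"
    by (auto intro!: nth_equalityI simp: gt_rows_def entry_array_of)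
qed

lemma bij_betw_gt_rows:
  "bij_betw gt_rows (midpoint_arrays g :: (real ^ ('n::finite) gt_index) set)
    (walks next_rows (CARD('n) - 1) (map g [1..<Suc CARD('n)]))"
proof (rule bij_betwI')
  fix c assume c: "c \<in> walks next_rows (CARD('n) - 1) (map g [1..<Suc CARD('n)])"
  then have "c \<in> range (gt_rows :: real ^ 'n gt_index \<Rightarrow> real list list)"
    by (rule walks_next_rows_in_range_gt_rows) simp
  then obtain s :: "real ^ 'n gt_index" where "c = gt_rows s" ..
  then show "\<exists>s\<in>midpoint_arrays g :: (real ^ 'n gt_index) set. c = gt_rows s"
    using c gt_rows_mem_walks_iff by blast
qed (simp_all only: gt_rows_inject gt_rows_mem_walks_iff)

subsection \<open>The sum over all faces\<close>

lemma t_fact_eq_q_fact: "t_fact l = q_fact t_var l"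
  by (simp add: t_fact_def q_fact_def q_num_def)

lemma t_fact_nonzero: "t_fact l \<noteq> 0"
proof -
  have "poly (t_fact l) 1 = fact l"
    by (simp add: t_fact_def poly_prod poly_sum poly_power fact_prod)
  then show ?thesis by auto
qed

lemma t_multinomial_eqI:
  assumes "p * (\<Prod>l\<leftarrow>ls. t_fact l) = t_fact n"
  shows "to_fract p = t_multinomial n ls"
proof -
  have "to_fract (\<Prod>l\<leftarrow>ls. t_fact l) = (\<Prod>l\<leftarrow>ls. to_fract (t_fact l))"
    by (induction ls) simp_all
  moreover have "(\<Prod>l\<leftarrow>ls. to_fract (t_fact l)) \<noteq> 0"
    using t_fact_nonzero by (auto simp: prod_list_zero_iff)
  ultimately show ?thesis
    unfolding t_multinomial_def assms[symmetric] by simp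
qed

lemma prod_list_partition_type: "(\<Prod>l\<leftarrow>partition_type xs. t_fact l) = count_fact t_var xs"
proof -
  let ?ys = "rev (sorted_list_of_set (set xs))"
  have "(\<Prod>l\<leftarrow>partition_type xs. t_fact l) = (\<Prod>x\<leftarrow>?ys. q_fact t_var (count_list xs x))"
    by (simp add: partition_type_def t_fact_eq_q_fact o_def)
  also have "\<dots> = (\<Prod>x\<in>set ?ys. q_fact t_var (count_list xs x))"
    by (rule prod.distinct_set_conv_list[symmetric]) simp
  finally show ?thesis by (simp add: count_fact_def)
qed

theorem sum_faces_mult_count_fact:
  assumes g: "antimono_on {1..CARD('n::finite)} g"
  shows "(\<Sum>f | f face_of (gt_polytope g :: (real ^ 'n gt_index) set) \<and> f \<noteq> {}.
      (-1) ^ nat (aff_dim f) * face_weight f) * count_fact t_var (map g [1..<Suc CARD('n)]) =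
    t_fact CARD('n)"
proof -
  let ?M = "midpoint_arrays g :: (real ^ 'n gt_index) set"
  let ?r = "map g [1..<Suc CARD('n)]"
  have "(\<Sum>f | f face_of (gt_polytope g :: (real ^ 'n gt_index) set) \<and> f \<noteq> {}.
      (-1) ^ nat (aff_dim f) * face_weight f) =
    (\<Sum>s\<in>?M. (-1) ^ nat (aff_dim (gt_face g s)) * face_weight (gt_face g s))"
    by (rule sum.reindex_bij_betw[OF bij_betw_midpoint_arrays_faces[OF g], symmetric])
  also have "\<dots> = (\<Sum>s\<in>?M. walk_weight (signed_row_weight t_var) (gt_rows s))"
  proof (rule sum.cong[OF refl])
    fix s assume "s \<in> ?M"
    then have "s \<in> gt_polytope g"
      using midpoint_arrays_subset_gt_polytope[OF g] by blast
    moreover from this have "interlacing s"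
      by (simp add: mem_gt_polytope_iff)
    ultimately show "(-1) ^ nat (aff_dim (gt_face g s)) * face_weight (gt_face g s) =
        walk_weight (signed_row_weight t_var) (gt_rows s)"
      by (simp add: aff_dim_tie_face dim_gt_flat face_weight_gt_face walk_weight_gt_rows)
  qed
  also have "\<dots> = (\<Sum>c\<in>walks next_rows (CARD('n) - 1) ?r. walk_weight (signed_row_weight t_var) c)"
    by (rule sum.reindex_bij_betw[OF bij_betw_gt_rows])
  also have "\<dots> * count_fact t_var ?r = q_fact t_var (Suc (CARD('n) - 1))"
  proof (rule sum_walks_mult_count_fact)
    show "sorted_wrt (\<ge>) ?r"
      by (auto simp: sorted_wrt_iff_nth_less intro!: monotone_onD[OF g] simp del: upt_Suc)
  qed simp
  finally show ?thesis by (simp add: t_fact_eq_q_fact)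
qed

lemma antimono_weight_coord: "antimono (weight_coord n a)"
  unfolding antimono_iff_le_Suc weight_coord_def by (auto intro: sum_mono2)

theorem theorem9:
  fixes a :: "nat \<Rightarrow> nat"
  assumes "CARD('n::finite) \<ge> 2"
    and "\<exists>k \<in> {1..CARD('n) - 1}. a k \<noteq> 0"
  shows "to_fract
      (\<Sum>f | f face_of (GT_polytope a :: (real ^ 'n gt_index) set) \<and> f \<noteq> {}.
         (-1) ^ nat (aff_dim f) * face_weight f)
    = t_multinomial CARD('n)
        (partition_type (map (weight_coord CARD('n) a) [1..<CARD('n)] @ [0]))"
proof (rule t_multinomial_eqI)
  let ?xs = "map (weight_coord CARD('n) a) [1..<CARD('n)] @ [0]"
  let ?g = "\<lambda>j. real (weight_coord CARD('n) a j)"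
  have "antimono_on {1..CARD('n)} ?g"
    using antimono_weight_coord by (auto simp: monotone_on_def)
  note sum_faces_mult_count_fact[OF this]
  moreover have "map ?g [1..<Suc CARD('n)] = map real ?xs"
    using assms(1) by (simp add: weight_coord_def)
  moreover have "count_fact t_var (map real ?xs) = (\<Prod>l\<leftarrow>partition_type ?xs. t_fact l)"
    unfolding prod_list_partition_type by (rule count_fact_map) (simp add: inj_on_def)
  ultimately show "(\<Sum>f | f face_of (GT_polytope a :: (real ^ 'n gt_index) set) \<and> f \<noteq> {}.
      (-1) ^ nat (aff_dim f) * face_weight f) * (\<Prod>l\<leftarrow>partition_type ?xs. t_fact l) = t_fact CARD('n)"
    by (simp only: GT_polytope_eq_gt_polytope)
qed

end
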